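(* Let $\bar V_n$ be the mean number of concurrent runs built on non-plane syntax trees of size $n$. Then $$\bar V_n\ \sim_{n\to\infty}\ \frac{2\sqrt2\,\pi n}{\gamma}\left(\frac{n\eta}{e}\right)^n,$$ where $\eta$ and $\gamma$ are the constants such that the number $T_n$ of unlabelled non-plane rooted trees of size $n$ satisfies $T_n\sim\frac{\gamma}{2\sqrt{\pi n^3}}\,\eta^{-n}$.
   Context: A non-plane syntax tree is an unlabelled rooted tree in which the children of a node are not ordered (specification $\mathcal T=\mathcal Z\times\mathrm{MSet}(\mathcal T)$); its size is its number of nodes and $T_n$ is the number of such trees of size $n$. It is a known fact that $T_n\sim\frac{\gamma}{2\sqrt{\pi n^3}}\eta^{-n}$ with constants $\eta\in[1/4,1/e]$, $\eta\approx0.3383218$, and $\gamma\approx1.559490$. The concurrent runs built on a non-plane tree correspond to its increasing labellings, considered as non-plane labelled trees: an increasing non-plane rooted tree of size $n$ is a non-plane rooted tree whose nodes carry the distinct labels $1,\dots,n$, with labels increasing along every branch starting at the root (two labellings of the same shape are identified if they give isomorphic labelled rooted trees). $\bar V_n$ is the total number of increasing non-plane rooted trees of size $n$ divided by $T_n$. *)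

theory Defs
  imports Complex_Main "HOL-Library.Multiset" "HOL-Library.Landau_Symbols"
begin

text \<open>
  Rooted trees with a label at every node and an unordered collection of children. Since the
  children form a multiset, equality on this type is isomorphism of labelled rooted trees.
\<close>

datatype 'a tree = Node (root: 'a) (children: "'a tree multiset")

primrec labels :: "'a tree \<Rightarrow> 'a multiset" where
  "labels (Node a M) = add_mset a (\<Sum>\<^sub># (image_mset labels M))"

definition num_nodes :: "'a tree \<Rightarrow> nat" where
  "num_nodes t = size (labels t)"

text \<open>Labelling every node by the only element of \<^typ>\<open>unit\<close> carries no information.\<close>

type_synonym syntax_tree = "unit tree"

definition syntax_trees :: "nat \<Rightarrow> syntax_tree set" where
  "syntax_trees n = {t. num_nodes t = n}"

definition T :: "nat \<Rightarrow> nat" where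
  "T n = card (syntax_trees n)"

inductive increasing :: "'a::order tree \<Rightarrow> bool" where
  "(\<And>c. c \<in># M \<Longrightarrow> a < root c) \<Longrightarrow> (\<And>c. c \<in># M \<Longrightarrow> increasing c) \<Longrightarrow> increasing (Node a M)"

definition increasing_trees :: "nat \<Rightarrow> nat tree set" where
  "increasing_trees n = {t. labels t = mset_set {1..n} \<and> increasing t}"

definition mean_runs :: "nat \<Rightarrow> real" where
  "mean_runs n = real (card (increasing_trees n)) / real (T n)"

text \<open>
  The concurrent runs of a syntax tree are its increasing labellings. The quantity
  \<^const>\<open>mean_runs\<close> is their average number over all syntax trees with \<open>n\<close> nodes.
\<close>

definition shape :: "'a tree \<Rightarrow> syntax_tree" where
  "shape t = map_tree (\<lambda>_. ()) t"

definition runs :: "syntax_tree \<Rightarrow> nat tree set" where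
  "runs t = {l \<in> increasing_trees (num_nodes t). shape l = t}"

lemma num_nodes_Node: "num_nodes (Node a M) = Suc (\<Sum>c\<in>#M. num_nodes c)"
  by (simp add: num_nodes_def) (induction M; simp add: num_nodes_def)

lemma num_nodes_nonzero: "num_nodes t \<noteq> 0"
  by (cases t) (simp add: num_nodes_Node)

lemma num_nodes_shape: "num_nodes (shape t) = num_nodes t"
proof (induction t)
  case (Node a M)
  then show ?case
    by (simp add: shape_def num_nodes_Node multiset.map_comp o_def cong: image_mset_cong)
qed

lemma size_le_sum_num_nodes: "size M \<le> (\<Sum>c\<in>#M. num_nodes c)"
proof (induction M)
  case (add x M)
  then show ?case using num_nodes_nonzero[of x] by simp
qed simp

lemma finite_bounded_trees:
  assumes "finite A"
  shows "finite {t. num_nodes t \<le> n \<and> set_mset (labels t) \<subseteq> A}"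
proof (induction n)
  case 0
  have "{t. num_nodes t \<le> 0 \<and> set_mset (labels t) \<subseteq> A} = {}"
    by (simp add: num_nodes_nonzero)
  then show ?case by (metis finite.emptyI)
next
  case (Suc n)
  let ?B = "{t. num_nodes t \<le> n \<and> set_mset (labels t) \<subseteq> A}"
  let ?L = "{xs. set xs \<subseteq> ?B \<and> length xs \<le> n}"
  have "{t. num_nodes t \<le> Suc n \<and> set_mset (labels t) \<subseteq> A}
          \<subseteq> (\<lambda>(a, xs). Node a (mset xs)) ` (A \<times> ?L)"
  proof
    fix t assume t: "t \<in> {t. num_nodes t \<le> Suc n \<and> set_mset (labels t) \<subseteq> A}"
    obtain a M where tM: "t = Node a M" by (cases t)
    obtain xs where xs: "M = mset xs" by (metis ex_mset)
    from t tM have le: "(\<Sum>c\<in>#M. num_nodes c) \<le> n" and a: "a \<in> A"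
      by (auto simp: num_nodes_Node)
    have "c \<in> ?B" if c: "c \<in># M" for c
    proof -
      from c obtain N where N: "M = add_mset c N" by (metis multi_member_split)
      show ?thesis using t tM le N by auto
    qed
    moreover have "length xs \<le> n"
      using size_le_sum_num_nodes[of M] le xs by simp
    ultimately have "xs \<in> ?L" using xs by auto
    then show "t \<in> (\<lambda>(a, xs). Node a (mset xs)) ` (A \<times> ?L)"
      using a tM xs by (intro image_eqI[of _ _ "(a, xs)"]) auto
  qed
  moreover have "finite ?L" using Suc by (rule finite_lists_length_le)
  ultimately show ?case using assms by (meson finite_SigmaI finite_imageI finite_subset)
qed

lemma finite_syntax_trees: "finite (syntax_trees n)"
  by (rule finite_subset[OF _ finite_bounded_trees[of UNIV n]]) (auto simp: syntax_trees_def)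

lemma finite_increasing_trees: "finite (increasing_trees n)"
  by (rule finite_subset[OF _ finite_bounded_trees[of "{1..n}" n]])
     (auto simp: increasing_trees_def num_nodes_def)

lemma mean_runs_eq_average:
  "mean_runs n = (\<Sum>t\<in>syntax_trees n. real (card (runs t))) / real (card (syntax_trees n))"
proof -
  have nn: "num_nodes l = n" if "l \<in> increasing_trees n" for l
    using that by (simp add: increasing_trees_def num_nodes_def)
  have "increasing_trees n = (\<Union>t\<in>syntax_trees n. runs t)"
    using nn by (auto simp: syntax_trees_def runs_def num_nodes_shape)
  also have "card \<dots> = (\<Sum>t\<in>syntax_trees n. card (runs t))"
    by (rule card_UN_disjoint)
       (auto simp: finite_syntax_trees runs_def intro: finite_subset[OF _ finite_increasing_trees])
  finally show ?thesis by (simp add: mean_runs_def T_def)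
qed

end

theory Submission
  imports "HOL-Analysis.Gamma_Function" "HOL-Real_Asymp.Real_Asymp" Defs
begin

text \<open>
  The node labelled \<open>n + 1\<close> of an increasing tree with \<open>n + 1\<close> nodes is a leaf. Removing it leaves an
  increasing tree with \<open>n\<close> nodes, and it could have been attached to any of these \<open>n\<close> nodes, so there
  are \<open>(n - 1)!\<close> increasing trees with \<open>n\<close> nodes. Dividing Stirling's formula for \<open>n! / n\<close> by the
  asymptotics of \<open>T\<close> gives the claim. Stirling's formula holds up to a constant because the logarithms
  of the quotients have summable increments of order \<open>1 / n\<^sup>2\<close>; Wallis' product identifies the
  constant.
\<close>

section \<open>Stirling's formula\<close>

text \<open>The factors are \<open>(2k)^2 / ((2k - 1) (2k + 1))\<close>. The numerators multiply to
  \<open>(2^n n!)^2\<close>, the denominators to the square of the product of the odd numbers below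
  \<open>2n\<close>, times \<open>2n + 1\<close>; that product of odd numbers is
  \<open>(2n)! / (2^n n!)\<close>.\<close>

lemma wallis_prod_eq:
  "(\<Prod>k=1..n. 4 * real k ^ 2 / (4 * real k ^ 2 - 1))
     = (4 ^ n * fact n ^ 2) ^ 2 / (fact (2 * n) ^ 2 * (2 * real n + 1))"
proof (induction n)
  case (Suc n)
  define x where "x = real n"
  define F where "F = (fact (2 * n) :: real)"
  define G where "G = (fact n :: real)"
  define P where "P = (4 ^ n :: real)"
  have pos: "x \<ge> 0" "F > 0" by (auto simp: x_def F_def)
  have eqs: "fact (2 * Suc n) = (2 * x + 2) * (2 * x + 1) * F" "fact (Suc n) = (x + 1) * G"
    "4 ^ Suc n = 4 * P" "real (Suc n) = x + 1"
    by (auto simp: x_def F_def G_def P_def add.commute)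
  have nz: "2 * x + 1 \<noteq> 0" "2 * x + 3 \<noteq> 0" "x + 1 \<noteq> 0" "F \<noteq> 0" using pos by auto
  have fac: "4 * (x + 1) ^ 2 - 1 = (2 * x + 1) * (2 * x + 3)" "2 * (x + 1) + 1 = 2 * x + 3"
    "2 * x + 2 = 2 * (x + 1)"
    by (simp_all add: power2_eq_square algebra_simps)
  have "(\<Prod>k=1..Suc n. 4 * real k ^ 2 / (4 * real k ^ 2 - 1))
          = (P * G ^ 2) ^ 2 / (F ^ 2 * (2 * x + 1)) * (4 * (x + 1) ^ 2 / (4 * (x + 1) ^ 2 - 1))"
    using Suc by (simp add: F_def G_def P_def x_def add.commute)
  also have "\<dots> = (4 * P * ((x + 1) * G) ^ 2) ^ 2
                  / (((2 * x + 2) * (2 * x + 1) * F) ^ 2 * (2 * (x + 1) + 1))"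
    unfolding fac using nz
    by (simp add: divide_simps) (simp add: power2_eq_square power4_eq_xxxx algebra_simps)
  finally show ?case unfolding eqs .
qed simp

lemma stirling: "fact \<sim>[at_top] (\<lambda>n. sqrt (2 * pi * real n) * (real n / exp 1) ^ n)"
proof -
  define s where "s n = fact n / (sqrt (real n) * (real n / exp 1) ^ n)" for n :: nat
  define d where "d n = 1 - (real n + 1 / 2) * ln (1 + 1 / real n)" for n :: nat
  have s_pos: "s n > 0" if "n > 0" for n
    using that by (simp add: s_def)
  have ln_s: "ln (s n) = ln (fact n) - ln (real n) / 2 - real n * (ln (real n) - 1)" if "n > 0" for n
    using that by (simp add: s_def ln_div ln_mult ln_sqrt ln_realpow)
  \<comment> \<open>Indices start at 1, because division by zero makes \<open>s 0 = 0\<close>,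
    outside the domain of \<open>ln_s\<close>.\<close>
  have diff: "ln (s (Suc (Suc n))) - ln (s (Suc n)) = d (Suc n)" for n
  proof -
    have "ln (1 + 1 / real (Suc n)) = ln (real (Suc (Suc n)) / real (Suc n))"
      by (simp add: field_simps)
    also have "\<dots> = ln (real (Suc (Suc n))) - ln (real (Suc n))"
      by (subst ln_div) auto
    finally have 1: "ln (1 + 1 / real (Suc n)) = ln (real (Suc (Suc n))) - ln (real (Suc n))" .
    have "(fact (Suc (Suc n)) :: real) = real (Suc (Suc n)) * fact (Suc n)"
      by (rule fact_Suc)
    then have 2: "ln (fact (Suc (Suc n)) :: real) = ln (real (Suc (Suc n))) + ln (fact (Suc n))"
      by (simp add: ln_mult del: fact_Suc of_nat_Suc)
    have 3: "real (Suc (Suc n)) = real (Suc n) + 1" by simp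
    show ?thesis
      unfolding d_def ln_s[OF zero_less_Suc] 1 2
      unfolding 3 by (simp add: algebra_simps add_divide_distrib diff_divide_distrib)
  qed
  have "summable d"
  proof (rule summable_comparison_test_bigo)
    \<comment> \<open>Expanding \<open>ln (1 + 1/n)\<close>, the summand 1/2 in \<open>d\<close>,
      which stems from the factor \<open>sqrt n\<close> of \<open>s\<close>, cancels the term of
      order \<open>1/n\<close>; what remains is \<open>-1 / (12 n^2)\<close> to leading
      order.\<close>
    show "d \<in> O(\<lambda>n. 1 / real n ^ 2)" unfolding d_def by real_asymp
    show "summable (\<lambda>n. norm (1 / real n ^ 2))"
      using inverse_power_summable[of 2, where ?'a = real] by (simp add: field_simps)
  qed
  then have "summable (\<lambda>n. d (Suc n))" by (simp add: summable_Suc_iff)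
  then have "summable (\<lambda>n. ln (s (Suc (Suc n))) - ln (s (Suc n)))" by (simp add: diff)
  then obtain c where "(\<lambda>n. \<Sum>i<n. ln (s (Suc (Suc i))) - ln (s (Suc i))) \<longlonglongrightarrow> c"
    by (auto simp: summable_def sums_def)
  then have "(\<lambda>n. ln (s (Suc n)) - ln (s (Suc 0))) \<longlonglongrightarrow> c"
    by (simp only: sum_lessThan_telescope[of "\<lambda>n. ln (s (Suc n))"])
  from tendsto_add[OF this tendsto_const[of "ln (s (Suc 0))"]]
  obtain L where L: "(\<lambda>n. ln (s (Suc n))) \<longlonglongrightarrow> L" by auto
  have "(\<lambda>n. exp (ln (s (Suc n)))) \<longlonglongrightarrow> exp L" by (intro tendsto_intros L)
  then have "(\<lambda>n. s (Suc n)) \<longlonglongrightarrow> exp L" by (simp add: s_pos)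
  then have lim: "s \<longlonglongrightarrow> exp L" by (rule LIMSEQ_imp_Suc)
  then have lim2: "(\<lambda>n. s (2 * n)) \<longlonglongrightarrow> exp L"
    by (rule filterlim_compose) (rule mult_nat_left_at_top, simp)
  \<comment> \<open>This quotient has the unknown limit \<open>exp L\<close> before the outer square
    is taken, while the powers of \<open>n / e\<close> cancel in it. It can therefore be computed in
    a second way, by Wallis' product.\<close>
  have "(\<lambda>n. (s n ^ 2 / s (2 * n)) ^ 2) \<longlonglongrightarrow> (exp L ^ 2 / exp L) ^ 2"
    by (intro tendsto_intros lim lim2) auto
  then have limL: "(\<lambda>n. (s n ^ 2 / s (2 * n)) ^ 2) \<longlonglongrightarrow> exp L ^ 2"
    by (simp add: power2_eq_square)
  have eq: "(s n ^ 2 / s (2 * n)) ^ 2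
      = (\<Prod>k=1..n. 4 * real k ^ 2 / (4 * real k ^ 2 - 1)) * ((2 * real n + 1) * 2 / real n)"
    if n: "n > 0" for n
  proof -
    define q where "q = (real n / exp 1) ^ n"
    have q: "q > 0" using n by (simp add: q_def)
    have "(real (2 * n) / exp 1) ^ (2 * n) = ((2 * (real n / exp 1)) ^ n) ^ 2"
      by (simp add: power_mult[symmetric] mult.commute)
    also have "\<dots> = (2 ^ n) ^ 2 * q ^ 2"
      by (simp only: q_def power_mult_distrib)
    also have "(2 ^ n) ^ 2 = (4 ^ n :: real)"
      by (simp add: power2_eq_square flip: power_mult_distrib)
    finally have q2: "(real (2 * n) / exp 1) ^ (2 * n) = 4 ^ n * q ^ 2" .
    have s: "s n ^ 2 = fact n ^ 2 / (real n * q ^ 2)"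
      by (simp add: s_def q_def power_divide power_mult_distrib)
    have s2: "s (2 * n) ^ 2 = fact (2 * n) ^ 2 / (2 * real n * (4 ^ n * q ^ 2) ^ 2)"
      unfolding s_def q2 by (simp add: power_divide power_mult_distrib)
    have "(s n ^ 2 / s (2 * n)) ^ 2 = (4 ^ n * fact n ^ 2) ^ 2 / fact (2 * n) ^ 2 * (2 / real n)"
      unfolding power_divide s2 s using q n
      by (simp add: divide_simps power_mult_distrib) (simp add: power2_eq_square)
    also have "\<dots> = (4 ^ n * fact n ^ 2) ^ 2 / (fact (2 * n) ^ 2 * (2 * real n + 1))
                    * ((2 * real n + 1) * 2 / real n)"
      by (simp add: divide_simps add_nonneg_eq_0_iff)
    finally show ?thesis unfolding wallis_prod_eq .
  qed
  have "(\<lambda>n. (2 * real n + 1) * 2 / real n) \<longlonglongrightarrow> 4" by real_asymp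
  from tendsto_mult[OF wallis this]
  have "(\<lambda>n. (s n ^ 2 / s (2 * n)) ^ 2) \<longlonglongrightarrow> pi / 2 * 4"
    by (rule Lim_transform_eventually) (use eventually_gt_at_top[of 0] in eventually_elim, simp add: eq)
  \<comment> \<open>The two evaluations of the same limit are compared.\<close>
  with limL have "exp L ^ 2 = 2 * pi" using LIMSEQ_unique by fastforce
  then have "exp L = sqrt (2 * pi)" by (metis exp_ge_zero real_sqrt_unique)
  with lim have "(\<lambda>n. s n / sqrt (2 * pi)) \<longlonglongrightarrow> sqrt (2 * pi) / sqrt (2 * pi)"
    by (intro tendsto_intros) auto
  then have "(\<lambda>n. fact n / (sqrt (2 * pi * real n) * (real n / exp 1) ^ n)) \<longlonglongrightarrow> 1"
    by (simp add: s_def real_sqrt_mult mult_ac)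
  then show ?thesis by (rule asymp_equivI')
qed

section \<open>Counting increasing trees\<close>

text \<open>Every node labelled \<open>v\<close> gets a new leaf; with distinct labels this is a
  single node, so no position in the tree has to be named. The recursion treats only the old
  children, so new leaves gain none.\<close>

primrec attach :: "'a \<Rightarrow> 'a \<Rightarrow> 'a tree \<Rightarrow> 'a tree" where
  "attach v x (Node a M) =
     Node a (image_mset (attach v x) M + (if a = v then {#Node x {#}#} else {#}))"

primrec prune :: "'a \<Rightarrow> 'a tree \<Rightarrow> 'a tree" where
  "prune x (Node a M) = Node a (filter_mset (\<lambda>c. root c \<noteq> x) (image_mset (prune x) M))"

text \<open>Recovers the place of attachment. A multiset adds up over subtrees, so no case
  distinction is needed on where \<open>x\<close> occurs.\<close>

primrec parents :: "'a \<Rightarrow> 'a tree \<Rightarrow> 'a multiset" where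
  "parents x (Node a M) =
     replicate_mset (size (filter_mset (\<lambda>c. root c = x) M)) a + \<Sum>\<^sub># (image_mset (parents x) M)"

lemma root_attach [simp]: "root (attach v x t) = root t"
  by (cases t) simp

lemma root_prune [simp]: "root (prune x t) = root t"
  by (cases t) simp

lemma root_in_labels [simp]: "root t \<in># labels t"
  by (cases t) simp

lemma root_neqI: "x \<notin># labels t \<Longrightarrow> root t \<noteq> x"
  using root_in_labels by metis

lemma replicate_mset_plus: "replicate_mset (m + n) x = replicate_mset m x + replicate_mset n x"
  by (rule multiset_eqI) simp

lemma labels_child_subset: "c \<in># M \<Longrightarrow> labels c \<subseteq># labels (Node a M)"
  by (auto dest!: multi_member_split simp: subset_mset.add_increasing subset_mset.le_iff_add)

lemma labels_attach: "labels (attach v x t) = labels t + replicate_mset (count (labels t) v) x"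
proof (induction t)
  case (Node a M)
  have "(\<Sum>c\<in>#M. labels (attach v x c))
          = (\<Sum>c\<in>#M. labels c) + replicate_mset (count (\<Sum>c\<in>#M. labels c) v) x"
    using Node by (induction M) (auto simp: replicate_mset_plus)
  then show ?case by (auto simp: multiset.map_comp o_def)
qed

lemma attach_id: "v \<notin># labels t \<Longrightarrow> attach v x t = t"
proof (induction t)
  case (Node a M)
  then have "image_mset (attach v x) M = image_mset id M"
    by (intro image_mset_cong) auto
  with Node.prems show ?case by auto
qed

text \<open>As \<open>x\<close> is fresh, the only nodes that pruning finds are the new
  leaves.\<close>

lemma prune_attach: "x \<notin># labels t \<Longrightarrow> prune x (attach v x t) = t"
proof (induction t)
  case (Node a M)
  have "image_mset (prune x \<circ> attach v x) M = image_mset id M"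
    using Node by (intro image_mset_cong) auto
  moreover have "filter_mset (\<lambda>c. root c \<noteq> x) M = filter_mset (\<lambda>c. True) M"
    using Node.prems by (intro filter_mset_cong) (auto dest: root_neqI)
  ultimately show ?case by (simp add: multiset.map_comp)
qed

lemma parents_attach:
  "x \<notin># labels t \<Longrightarrow> parents x (attach v x t) = replicate_mset (count (labels t) v) v"
proof (induction t)
  case (Node a M)
  have "filter_mset (\<lambda>c. root c = x) (image_mset (attach v x) M) = {#}"
    using Node.prems by (auto simp: root_neqI)
  moreover have "(\<Sum>c\<in>#M. parents x (attach v x c)) = replicate_mset (count (\<Sum>c\<in>#M. labels c) v) v"
    using Node by (induction M) (auto simp: replicate_mset_plus)
  ultimately show ?case by (auto simp: multiset.map_comp o_def)
qed

section \<open>Increasing trees and their largest label\<close>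

lemma increasing_Node:
  "increasing (Node a M) \<longleftrightarrow> (\<forall>c\<in>#M. a < root c \<and> increasing c)"
  by (subst increasing.simps) auto

lemma increasing_attach:
  "increasing t \<Longrightarrow> (\<And>y. y \<in># labels t \<Longrightarrow> y < x) \<Longrightarrow> increasing (attach v x t)"
  by (induction t) (auto simp: increasing_Node)

lemma increasing_root_le: "increasing t \<Longrightarrow> y \<in># labels t \<Longrightarrow> root t \<le> y"
proof (induction t)
  case (Node a M)
  then show ?case by (auto simp: increasing_Node) (meson order.strict_implies_order order_less_le_trans)
qed

text \<open>A child of the node with the largest label \<open>x\<close> would have a larger label,
  so that node is a leaf and can be detached from its parent \<open>v\<close>. The induction
  descends to the child whose subtree contains \<open>x\<close>. Distinctness and maximality are
  assumed instead of the label set \<open>{1..n}\<close> because they pass to subtrees.\<close>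

lemma increasing_eq_attach:
  assumes "increasing t" "\<And>y. count (labels t) y \<le> 1" "\<And>y. y \<in># labels t \<Longrightarrow> y \<le> x"
    and "x \<in># labels t" "root t \<noteq> x"
  shows "\<exists>v t'. t = attach v x t' \<and> labels t = add_mset x (labels t') \<and> increasing t' \<and> v \<in># labels t'"
  using assms
proof (induction t rule: tree.induct)
  case (Node a M)
  then obtain c where c: "c \<in># M" "x \<in># labels c" by auto
  then obtain N where M: "M = add_mset c N" by (metis multi_member_split)
  have inc: "increasing c" "a < root c" "\<forall>c\<in>#N. a < root c \<and> increasing c"
    using Node.prems(1) by (auto simp: M increasing_Node)
  \<comment> \<open>Labels are distinct, so attaching at a node of \<open>c\<close> changes neither
    the siblings of \<open>c\<close> nor the children of the root directly.\<close>
  have disj: "v \<notin># (\<Sum>c\<in>#N. labels c)" "v \<noteq> a" if "v \<in># labels c" for v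
  proof -
    have "1 \<le> count (labels c) v" using that by simp
    moreover have "count (labels c) v + count (\<Sum>c\<in>#N. labels c) v + (if v = a then 1 else 0) \<le> 1"
      using Node.prems(2)[of v] by (auto simp: M split: if_splits)
    ultimately have "count (\<Sum>c\<in>#N. labels c) v = 0" "v \<noteq> a" by arith+
    then show "v \<notin># (\<Sum>c\<in>#N. labels c)" "v \<noteq> a" by (auto simp only: not_in_iff)
  qed
  have fix_N: "image_mset (attach v x) N = N" if "v \<notin># (\<Sum>c\<in>#N. labels c)" for v
  proof -
    have "image_mset (attach v x) N = image_mset id N"
      using that by (intro image_mset_cong) (auto intro: attach_id)
    then show ?thesis by simp
  qed
  show ?case
  proof (cases "root c = x")
    case True
    have leaf: "c = Node x {#}"
    proof (cases c)
      case (Node b K)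
      have "K = {#}"
      proof (rule ccontr)
        assume "K \<noteq> {#}"
        then obtain k where k: "k \<in># K" by auto
        then have "x < root k" using inc(1) True Node by (auto simp: increasing_Node)
        moreover have "root k \<le> x"
          using k c(1) Node Node.prems(3)[of "root k"] root_in_labels[of k] by fastforce
        ultimately show False by simp
      qed
      then show ?thesis using Node True by simp
    qed
    \<comment> \<open>The new leaf goes below the root only: \<open>a\<close> does not recur in the
      other subtrees.\<close>
    have "a \<notin># (\<Sum>c\<in>#N. labels c)"
    proof -
      have "count (\<Sum>c\<in>#N. labels c) a = 0" using Node.prems(2)[of a] by (simp add: M)
      then show ?thesis by (simp only: not_in_iff)
    qed
    then have "Node a M = attach a x (Node a N)"
      by (simp add: fix_N M leaf)
    moreover have "increasing (Node a N)" using inc by (auto simp: increasing_Node)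
    moreover have "labels (Node a M) = add_mset x (labels (Node a N))"
      by (simp add: M leaf)
    moreover have "a \<in># labels (Node a N)" by simp
    ultimately show ?thesis by blast
  next
    case False
    have sub: "labels c \<subseteq># labels (Node a M)" using c(1) by (rule labels_child_subset)
    have "count (labels c) y \<le> 1" for y
      using mset_subset_eq_count[OF sub, of y] Node.prems(2)[of y] by linarith
    moreover have "y \<le> x" if "y \<in># labels c" for y
      using mset_subset_eqD[OF sub that] Node.prems(3) by blast
    ultimately obtain v c' where IH: "c = attach v x c'" "labels c = add_mset x (labels c')"
      "increasing c'" "v \<in># labels c'"
      using Node.IH[OF c(1) inc(1)] c(2) False by blast
    then have "v \<in># labels c" by simp
    from disj[OF this] have "Node a M = attach v x (Node a (add_mset c' N))"
      by (simp add: fix_N M IH(1))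
    moreover have "increasing (Node a (add_mset c' N))"
      using inc IH(1,3) by (auto simp: increasing_Node)
    moreover have "labels (Node a M) = add_mset x (labels (Node a (add_mset c' N)))"
      by (simp add: M IH(2))
    moreover have "v \<in># labels (Node a (add_mset c' N))" using IH(4) by simp
    ultimately show ?thesis by blast
  qed
qed

text \<open>Injective, since \<open>prune\<close> recovers the tree and \<open>parents\<close> the
  attachment node; surjective by detaching the largest label. For \<open>n = 0\<close> the domain is
  empty, but there is one tree with a single node.\<close>

lemma bij_betw_attach:
  assumes "n > 0"
  shows "bij_betw (\<lambda>(t, v). attach v (Suc n) t) (increasing_trees n \<times> {1..n}) (increasing_trees (Suc n))"
proof (rule bij_betwI')
  let ?I = increasing_trees and ?x = "Suc n"
  have interval: "{Suc 0..?x} = insert ?x {Suc 0..n}" by auto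
  fix p assume p: "p \<in> ?I n \<times> {1..n}"
  then obtain t v where tv: "p = (t, v)" "t \<in> ?I n" "v \<in> {1..n}" by auto
  then show "(case p of (t, v) \<Rightarrow> attach v ?x t) \<in> ?I ?x"
    by (auto simp: increasing_trees_def labels_attach interval intro!: increasing_attach)
  fix q assume q: "q \<in> ?I n \<times> {1..n}"
  then obtain u w where uw: "q = (u, w)" "u \<in> ?I n" "w \<in> {1..n}" by auto
  have fresh: "?x \<notin># labels t" "?x \<notin># labels u"
    using tv uw by (auto simp: increasing_trees_def)
  have "t = u \<and> v = w" if eq: "attach v ?x t = attach w ?x u"
  proof
    show "t = u" using arg_cong[OF eq, of "prune ?x"] fresh by (simp add: prune_attach)
    have "{#v#} = {#w#}" using arg_cong[OF eq, of "parents ?x"] fresh tv uw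
      by (simp add: parents_attach increasing_trees_def)
    then show "v = w" by simp
  qed
  then show "((case p of (t, v) \<Rightarrow> attach v ?x t) = (case q of (t, v) \<Rightarrow> attach v ?x t)) = (p = q)"
    by (auto simp: tv(1) uw(1))
next
  let ?I = increasing_trees and ?x = "Suc n"
  have interval: "{Suc 0..?x} = insert ?x {Suc 0..n}" by auto
  fix t assume "t \<in> ?I ?x"
  then have t: "labels t = mset_set {1..?x}" "increasing t" by (auto simp: increasing_trees_def)
  \<comment> \<open>The root carries the least label, which differs from the largest as
    \<open>n > 0\<close>.\<close>
  have "root t \<le> 1" using increasing_root_le[OF t(2), of 1] t(1) by simp
  then have "root t \<noteq> ?x" using assms by simp
  then obtain v t' where *: "t = attach v ?x t'" "labels t = add_mset ?x (labels t')"
    "increasing t'" "v \<in># labels t'"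
    using increasing_eq_attach[OF t(2), of ?x] t(1) by (fastforce simp: count_mset_set')
  have "labels t' = mset_set {1..n}" using *(2) by (simp add: t(1) interval)
  with * show "\<exists>p\<in>?I n \<times> {1..n}. t = (case p of (t, v) \<Rightarrow> attach v ?x t)"
    by (intro bexI[of _ "(t', v)"]) (auto simp: increasing_trees_def)
qed

lemma increasing_trees_1: "increasing_trees 1 = {Node 1 {#}}"
proof -
  have "t = Node 1 {#}" if "labels t = {#1#}" for t :: "nat tree"
  proof (cases t)
    case (Node a M)
    with that have "a = 1" "(\<Sum>c\<in>#M. labels c) = {#}" by auto
    moreover have "M = {#}"
      using calculation(2) by (cases M) (auto, metis empty_not_add_mset labels.simps tree.exhaust)
    ultimately show ?thesis using Node by simp
  qed
  then show ?thesis by (auto simp: increasing_trees_def increasing_Node)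
qed

text \<open>Starting from the single tree with one node, the step from \<open>n\<close> to
  \<open>n + 1\<close> nodes multiplies the number by \<open>n\<close>.\<close>

lemma card_increasing_trees: "card (increasing_trees (Suc n)) = fact n"
proof (induction n)
  case 0
  then show ?case using increasing_trees_1 by simp
next
  case (Suc n)
  then show ?case using bij_betw_same_card[OF bij_betw_attach[of "Suc n"]]
    by (simp add: card_cartesian_product del: fact_Suc) (simp add: mult.commute)
qed

section \<open>Asymptotics of the mean\<close>

theorem theorem18:
  fixes \<eta> \<gamma> :: real
  assumes "(\<lambda>n. real (T n)) \<sim>[at_top]
             (\<lambda>n. \<gamma> / (2 * sqrt (pi * real n ^ 3)) * \<eta> powi (- int n))"
  shows "mean_runs \<sim>[at_top]
           (\<lambda>n. 2 * sqrt 2 * pi * real n / \<gamma> * (real n * \<eta> / exp 1) ^ n)"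
proof -
  have "(\<lambda>n. fact n / real n / real (T n)) \<sim>[at_top]
      (\<lambda>n. sqrt (2 * pi * real n) * (real n / exp 1) ^ n / real n
            / (\<gamma> / (2 * sqrt (pi * real n ^ 3)) * \<eta> powi (- int n)))"
    by (intro asymp_equiv_divide stirling assms asymp_equiv_refl)
  then show ?thesis
  proof (rule asymp_equiv_transfer)
    \<comment> \<open>For positive \<open>n\<close> the number \<open>(n - 1)!\<close> of increasing
      trees is \<open>n! / n\<close>, the form to which Stirling's formula applies.\<close>
    show "\<forall>\<^sub>F n in at_top. fact n / real n / real (T n) = mean_runs n"
      using eventually_gt_at_top[of 0]
    proof eventually_elim
      case (elim n)
      then obtain m where "n = Suc m" by (cases n) auto
      then show ?case by (simp add: mean_runs_def card_increasing_trees)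
    qed
    show "\<forall>\<^sub>F n in at_top. sqrt (2 * pi * real n) * (real n / exp 1) ^ n / real n
            / (\<gamma> / (2 * sqrt (pi * real n ^ 3)) * \<eta> powi (- int n))
          = 2 * sqrt 2 * pi * real n / \<gamma> * (real n * \<eta> / exp 1) ^ n"
      using eventually_gt_at_top[of 0]
    proof eventually_elim
      case (elim n)
      \<comment> \<open>The root from Stirling's formula meets the root in the denominator of the
        estimate for \<open>T\<close>. Together they give \<open>n^2\<close>, and the division by
        \<open>n\<close> leaves the linear factor of the claim.\<close>
      have "sqrt (2 * pi * real n) * sqrt (pi * real n ^ 3) = sqrt (2 * (pi * real n ^ 2) ^ 2)"
        unfolding real_sqrt_mult[symmetric] by (simp add: power2_eq_square power3_eq_cube mult_ac)
      also have "\<dots> = sqrt 2 * pi * real n ^ 2"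
        by (simp add: real_sqrt_mult)
      finally have sq: "sqrt (2 * pi * real n) * sqrt (pi * real n ^ 3) = sqrt 2 * pi * real n ^ 2" .
      have "\<eta> powi (- int n) = inverse (\<eta> ^ n)" by (simp add: power_int_minus)
      then have "sqrt (2 * pi * real n) * (real n / exp 1) ^ n / real n
            / (\<gamma> / (2 * sqrt (pi * real n ^ 3)) * \<eta> powi (- int n))
          = 2 * (sqrt (2 * pi * real n) * sqrt (pi * real n ^ 3)) / real n / \<gamma>
              * ((real n / exp 1) ^ n * \<eta> ^ n)"
        by (simp add: field_simps)
      also have "\<dots> = 2 * sqrt 2 * pi * real n / \<gamma> * (real n * \<eta> / exp 1) ^ n"
        unfolding sq using elim by (simp add: power2_eq_square flip: power_mult_distrib)
      finally show ?case .
    qed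
  qed
qed

end
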